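(* Let $n$ be a positive integer and let $\mathcal{A}\subset\{0,1\}^n$ satisfy $1\leq \log|\mathcal{A}|<n$. Then $$\mathsf{e}_{\leq 2}(\mathcal{A})\ \leq\ n\cdot \ell'\cdot|\mathcal{A}|,$$ where $$\ell'=\min\left\{\left\lceil\frac{\log|\mathcal{A}|}{\log n-\log\log|\mathcal{A}|}\right\rceil,\ \lfloor\log|\mathcal{A}|\rfloor\right\}.$$
   Context: All logarithms $\log$ are base two. $\mathsf{e}_{\leq 2}(\mathcal{A})$ denotes the number of unordered pairs of distinct vectors $x,y\in\mathcal{A}$ at Hamming distance at most $2$ (i.e. the number of edges induced by $\mathcal{A}$ in the graph on $\{0,1\}^n$ joining distinct vectors that differ in at most $2$ coordinates). *)

theory Defs
  imports Complex_Main "HOL-Library.FuncSet"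
begin

(* Vectors are extensional functions on the coordinate set {..<n} (value undefined outside it),
   so equality of functions is equality of vectors. *)
definition cube :: "nat \<Rightarrow> (nat \<Rightarrow> nat) set" where
  "cube n = {..<n} \<rightarrow>\<^sub>E {0, 1}"

definition hamming_dist :: "nat \<Rightarrow> (nat \<Rightarrow> nat) \<Rightarrow> (nat \<Rightarrow> nat) \<Rightarrow> nat" where
  "hamming_dist n x y = card {i \<in> {..<n}. x i \<noteq> y i}"

definition edges_le2 :: "nat \<Rightarrow> (nat \<Rightarrow> nat) set \<Rightarrow> (nat \<Rightarrow> nat) set set" where
  "edges_le2 n A = {{x, y} | x y. x \<in> A \<and> y \<in> A \<and> x \<noteq> y \<and> hamming_dist n x y \<le> 2}"

definition e_le2 :: "nat \<Rightarrow> (nat \<Rightarrow> nat) set \<Rightarrow> nat" where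
  "e_le2 n A = card (edges_le2 n A)"

end

theory Submission
  imports Defs "HOL-Combinatorics.Transposition"
begin

text \<open>
  Why the bound holds. Identify a vector with its support, a subset of \<open>{..<n}\<close>, so that the Hamming
  distance is the size of the symmetric difference. Two kinds of reflections act on these sets:
  flipping one coordinate, and exchanging two coordinates. Compressing a family along such a
  reflection (\<open>polarize\<close>) keeps its size and does not decrease the number of close pairs, so the family may be
  assumed to be a down-set that is closed under replacing an element by a smaller one
  (\<open>ex_shifted_down_set\<close>).

  Orient each edge from the set that contains the largest element in which its two ends differ. An
  edge that leaves \<open>x\<close> then goes to the symmetric difference of \<open>x\<close> and \<open>{a, b}\<close> for some \<open>a \<in> x\<close> and
  \<open>b \<le> a\<close>, so at most \<open>weight x\<close> edges leave \<open>x\<close>, the weight being the sum of the elements of \<open>x\<close>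
  counted from 1 (\<open>card_descending_pairs_le_weight\<close>). Hence it suffices to bound the weight of every
  single member \<open>x\<close> of a shifted down-set \<open>F\<close> by \<open>n * l'\<close>.

  Let \<open>L = log 2 (card F)\<close> and \<open>k = card x\<close>. All subsets of \<open>x\<close> belong to \<open>F\<close>, so \<open>k \<le> L\<close> and
  \<open>weight x \<le> n * \<lfloor>L\<rfloor>\<close>. For the other bound, choose disjoint sets \<open>B a \<subseteq> {..a}\<close> of size
  \<open>a div k + 1 = \<lceil>(a + 1) / k\<rceil>\<close> for \<open>a \<in> x\<close>; deleting each \<open>a\<close> or moving it to a point of \<open>B a\<close> leads to
  distinct members of \<open>F\<close>, so \<open>(\<Prod>a\<in>x. a div k + 2) \<le> card F\<close>
  (\<open>prod_le_card_shifted_down_set\<close>). The factor of \<open>a\<close> is at least \<open>1 + (a + 1) / k\<close>, so by concavity of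
  the logarithm it contributes at least \<open>(a + 1) / n * log 2 (1 + n / k) \<ge> (a + 1) / n * log 2 (n / L)\<close> to \<open>L\<close>. Summing over \<open>a\<close> gives
  \<open>weight x * log 2 (n / L) \<le> n * L\<close> (\<open>weight_mult_log_le\<close>).
\<close>

section \<open>Polarization\<close>

text \<open>
  The reflection \<open>\<sigma>\<close> exchanges the half \<open>U\<close> of \<open>X\<close> with its mirror image and fixes every other point.
  The last assumption says that points on the same side are related as soon as one of them is
  related to the reflection of the other: reflecting can only increase their distance.
\<close>

locale polarization =
  fixes X :: "'a set" and R :: "'a \<Rightarrow> 'a \<Rightarrow> bool" and \<sigma> :: "'a \<Rightarrow> 'a" and U :: "'a set"
  assumes finite_X: "finite X"
    and \<sigma>_in: "x \<in> X \<Longrightarrow> \<sigma> x \<in> X"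
    and \<sigma>_\<sigma>: "x \<in> X \<Longrightarrow> \<sigma> (\<sigma> x) = x"
    and U_away: "x \<in> X \<Longrightarrow> x \<in> U \<Longrightarrow> \<sigma> x \<notin> U"
    and fixed: "x \<in> X \<Longrightarrow> x \<notin> U \<Longrightarrow> \<sigma> x \<notin> U \<Longrightarrow> \<sigma> x = x"
    and R_\<sigma>: "x \<in> X \<Longrightarrow> y \<in> X \<Longrightarrow> R (\<sigma> x) (\<sigma> y) \<longleftrightarrow> R x y"
    and R_same_side: "x \<in> X \<Longrightarrow> y \<in> X \<Longrightarrow> x \<in> U \<Longrightarrow> y \<in> U \<Longrightarrow> R x (\<sigma> y) \<Longrightarrow> R x y"
begin

text \<open>In each orbit \<open>{x, \<sigma> x}\<close> that contains just one member of \<open>F\<close>, that member is moved out of \<open>U\<close>.\<close>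

definition polarize :: "'a set \<Rightarrow> 'a set" where
  "polarize F = {x \<in> X. if x \<in> U then x \<in> F \<and> \<sigma> x \<in> F
                        else if \<sigma> x \<in> U then x \<in> F \<or> \<sigma> x \<in> F else x \<in> F}"

lemma polarize_subset: "polarize F \<subseteq> X"
  by (auto simp: polarize_def)

lemma sum_\<sigma>: "(\<Sum>x\<in>X. f (\<sigma> x)) = (\<Sum>x\<in>X. f x)" for f :: "'a \<Rightarrow> nat"
  by (rule sum.reindex_bij_witness[of _ \<sigma> \<sigma>]) (auto simp: \<sigma>_\<sigma> \<sigma>_in)

lemma sum_symmetrized: "2 * (\<Sum>x\<in>X. f x) = (\<Sum>x\<in>X. f x + f (\<sigma> x))" for f :: "'a \<Rightarrow> nat"
  by (simp add: sum.distrib sum_\<sigma>)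

lemma sum_indicator: "F \<subseteq> X \<Longrightarrow> (\<Sum>x\<in>F. w x) = (\<Sum>x\<in>X. of_bool (x \<in> F) * w x)"
  for w :: "'a \<Rightarrow> nat"
  by (rule sum.mono_neutral_cong_left) (auto simp: finite_X)

lemma card_polarize:
  assumes "F \<subseteq> X"
  shows "card (polarize F) = card F"
proof -
  have "2 * card (polarize F) = 2 * (\<Sum>x\<in>polarize F. 1)" by simp
  also have "\<dots> = (\<Sum>x\<in>X. of_bool (x \<in> polarize F) + of_bool (\<sigma> x \<in> polarize F))"
    by (simp only: sum_indicator[OF polarize_subset] sum_symmetrized) simp
  also have "\<dots> = (\<Sum>x\<in>X. of_bool (x \<in> F) + of_bool (\<sigma> x \<in> F))"
    by (rule sum.cong) (auto simp: polarize_def \<sigma>_\<sigma> \<sigma>_in dest: U_away fixed)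
  also have "\<dots> = 2 * (\<Sum>x\<in>F. 1)"
    by (simp only: sum_indicator[OF assms] sum_symmetrized) simp
  finally show ?thesis by simp
qed

lemma weight_polarize_less:
  fixes w :: "'a \<Rightarrow> nat"
  assumes "F \<subseteq> X" and lighter: "\<And>x. x \<in> X \<Longrightarrow> x \<in> U \<Longrightarrow> w (\<sigma> x) < w x"
    and z: "z \<in> F" "z \<in> U" "\<sigma> z \<notin> F"
  shows "(\<Sum>x\<in>polarize F. w x) < (\<Sum>x\<in>F. w x)"
proof -
  define f where "f G x = of_bool (x \<in> G) * w x + of_bool (\<sigma> x \<in> G) * w (\<sigma> x)" for G x
  have "f (polarize F) x \<le> f F x" if "x \<in> X" for x
    using that lighter[of x] lighter[of "\<sigma> x"] U_away[of x] fixed[of x]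
    by (auto simp: f_def polarize_def \<sigma>_\<sigma> \<sigma>_in)
  moreover have "f (polarize F) z < f F z"
    using z lighter[of z] U_away[of z] \<open>F \<subseteq> X\<close>
    by (auto simp: f_def polarize_def \<sigma>_\<sigma> \<sigma>_in subset_iff)
  ultimately have "(\<Sum>x\<in>X. f (polarize F) x) < (\<Sum>x\<in>X. f F x)"
    using z \<open>F \<subseteq> X\<close> finite_X by (intro sum_strict_mono_ex1) auto
  moreover have "(\<Sum>x\<in>X. f G x) = 2 * (\<Sum>x\<in>G. w x)" if "G \<subseteq> X" for G
    unfolding sum_indicator[OF that] sum_symmetrized f_def ..
  ultimately show ?thesis
    using polarize_subset \<open>F \<subseteq> X\<close> by simp
qed

text \<open>
  Averaging over \<open>\<sigma>\<close> in both arguments reduces the claim to the four pairs formed from two orbits.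
  If both orbits are \<open>{x, \<sigma> x}\<close> and \<open>{y, \<sigma> y}\<close> with \<open>x\<close> and \<open>y\<close> in \<open>U\<close>, moving the members of \<open>F\<close> to the
  same side trades related pairs across the mirror for pairs on one side, which are then
  related as well. If a point of one orbit is fixed, it is related to both or neither of the points
  of the other orbit, and nothing changes.
\<close>

lemma card_related_pairs_polarize:
  assumes "F \<subseteq> X"
  shows "card {(x, y) \<in> F \<times> F. R x y} \<le> card {(x, y) \<in> polarize F \<times> polarize F. R x y}"
proof -
  define f :: "'a set \<Rightarrow> 'a \<Rightarrow> 'a \<Rightarrow> nat"
    where "f G x y = of_bool (x \<in> G \<and> y \<in> G \<and> R x y)" for G x y
  define g where "g G x y = f G x y + f G x (\<sigma> y) + f G (\<sigma> x) y + f G (\<sigma> x) (\<sigma> y)" for G x y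
  have double: "4 * card {(x, y) \<in> G \<times> G. R x y} = (\<Sum>x\<in>X. \<Sum>y\<in>X. g G x y)" if "G \<subseteq> X" for G
  proof -
    have "{(x, y) \<in> G \<times> G. R x y} = X \<times> X \<inter> {p. fst p \<in> G \<and> snd p \<in> G \<and> R (fst p) (snd p)}"
      using that by auto
    then have "card {(x, y) \<in> G \<times> G. R x y} = (\<Sum>p\<in>X \<times> X. f G (fst p) (snd p))"
      using finite_X by (simp only: f_def sum_of_bool_eq finite_cartesian_product of_nat_id)
    also have "\<dots> = (\<Sum>x\<in>X. \<Sum>y\<in>X. f G x y)"
      by (simp only: sum.cartesian_product case_prod_unfold)
    finally show ?thesis
      by (simp add: g_def sum.distrib sum_\<sigma>[of "f G _"] sum_\<sigma>[of "\<lambda>x. \<Sum>y\<in>X. f G x y"])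
  qed
  have g_\<sigma>: "g G (\<sigma> x) y = g G x y" "g G x (\<sigma> y) = g G x y" if "x \<in> X" "y \<in> X" for G x y
    using that by (simp_all add: g_def \<sigma>_\<sigma>)
  have U: "x \<in> polarize F \<longleftrightarrow> x \<in> F \<and> \<sigma> x \<in> F" "\<sigma> x \<in> polarize F \<longleftrightarrow> x \<in> F \<or> \<sigma> x \<in> F"
    if "x \<in> X" "x \<in> U" for x
    using that U_away[of x] by (auto simp: polarize_def \<sigma>_\<sigma> \<sigma>_in)
  \<comment> \<open>Every orbit is either a fixed point or has a point in \<open>U\<close>; as \<open>g\<close> depends on the orbits only,
    these representatives suffice.\<close>
  define fix_or_U where "fix_or_U x \<longleftrightarrow> x \<in> U \<or> \<sigma> x = x \<and> (x \<in> polarize F \<longleftrightarrow> x \<in> F)" for x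
  have normal: "g F x y \<le> g (polarize F) x y"
    if xy: "x \<in> X" "y \<in> X" and "fix_or_U x" "fix_or_U y" for x y
  proof -
    have R: "R (\<sigma> x) (\<sigma> y) \<longleftrightarrow> R x y" "R (\<sigma> x) y \<longleftrightarrow> R x (\<sigma> y)"
      using R_\<sigma>[of x y] R_\<sigma>[of x "\<sigma> y"] xy by (simp_all add: \<sigma>_\<sigma> \<sigma>_in)
    consider "x \<in> U" "y \<in> U"
      | "x \<in> U" "\<sigma> y = y" "y \<in> polarize F \<longleftrightarrow> y \<in> F"
      | "\<sigma> x = x" "x \<in> polarize F \<longleftrightarrow> x \<in> F" "y \<in> U"
      | "\<sigma> x = x" "x \<in> polarize F \<longleftrightarrow> x \<in> F" "\<sigma> y = y" "y \<in> polarize F \<longleftrightarrow> y \<in> F"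
      using \<open>fix_or_U x\<close> \<open>fix_or_U y\<close> unfolding fix_or_U_def by blast
    then show ?thesis
    proof cases
      case 1
      then show ?thesis
        using R_same_side[OF xy 1]
        by (auto simp: g_def f_def R U[OF xy(1) 1(1)] U[OF xy(2) 1(2)])
    next
      case 2
      then show ?thesis
        using R by (auto simp: g_def f_def U[OF xy(1) 2(1)])
    next
      case 3
      then show ?thesis
        using R by (auto simp: g_def f_def U[OF xy(2) 3(3)])
    qed (simp add: g_def f_def)
  qed
  have representative: "\<exists>x'\<in>{x, \<sigma> x}. fix_or_U x'" if "x \<in> X" for x
  proof (cases "x \<in> U \<or> \<sigma> x \<in> U")
    case False
    then show ?thesis
      using that fixed[of x] by (simp add: fix_or_U_def polarize_def)
  qed (auto simp: fix_or_U_def)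
  have "g F x y \<le> g (polarize F) x y" if "x \<in> X" "y \<in> X" for x y
  proof -
    obtain x' y' where "x' \<in> {x, \<sigma> x}" "fix_or_U x'" "y' \<in> {y, \<sigma> y}" "fix_or_U y'"
      using representative \<open>x \<in> X\<close> \<open>y \<in> X\<close> by meson
    moreover from this have "x' \<in> X" "y' \<in> X" "g G x' y' = g G x y" for G
      using that \<sigma>_in by (auto simp: g_\<sigma>)
    ultimately show ?thesis using normal by metis
  qed
  then have "(\<Sum>x\<in>X. \<Sum>y\<in>X. g F x y) \<le> (\<Sum>x\<in>X. \<Sum>y\<in>X. g (polarize F) x y)"
    by (intro sum_mono) auto
  then show ?thesis
    using double[OF assms] double[OF polarize_subset[of F]] by linarith
qed

end

section \<open>Reduction to shifted down-sets\<close>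

abbreviation close :: "nat set \<Rightarrow> nat set \<Rightarrow> bool" where
  "close x y \<equiv> card (sym_diff x y) \<le> 2"

abbreviation weight :: "nat set \<Rightarrow> nat" where
  "weight x \<equiv> \<Sum>a\<in>x. Suc a"

definition shifted_down_set :: "nat set set \<Rightarrow> bool" where
  "shifted_down_set F \<longleftrightarrow>
     (\<forall>x\<in>F. \<forall>a\<in>x. x - {a} \<in> F) \<and>
     (\<forall>x\<in>F. \<forall>a\<in>x. \<forall>b. b < a \<longrightarrow> b \<notin> x \<longrightarrow> insert b (x - {a}) \<in> F)"

text \<open>Two sets that both contain \<open>i\<close> agree at \<open>i\<close>, so flipping \<open>i\<close> in one of them adds a difference.\<close>

lemma polarization_flip:
  assumes "i < n"
  shows "polarization (Pow {..<n}) close (\<lambda>x. sym_diff x {i}) {x. i \<in> x}"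
proof
  fix x y :: "nat set"
  assume "x \<in> Pow {..<n}" "y \<in> Pow {..<n}"
  then have fin: "finite (sym_diff x (sym_diff y {i}))"
    by (auto intro: finite_subset)
  show "close (sym_diff x {i}) (sym_diff y {i}) \<longleftrightarrow> close x y"
  proof -
    have "sym_diff (sym_diff x {i}) (sym_diff y {i}) = sym_diff x y" by auto
    then show ?thesis by simp
  qed
  assume "x \<in> {x. i \<in> x}" "y \<in> {x. i \<in> x}"
  then have "sym_diff x y \<subseteq> sym_diff x (sym_diff y {i})" by auto
  then show "close x (sym_diff y {i}) \<Longrightarrow> close x y"
    using card_mono[OF fin] le_trans by blast
qed (use assms in auto)

text \<open>
  Two sets that both contain \<open>j\<close> but not \<open>i\<close> agree at both, so exchanging \<open>i\<close> and \<open>j\<close> in one of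
  them adds two differences.
\<close>

lemma polarization_transpose:
  assumes "i < n" "j < n" "i \<noteq> j"
  shows "polarization (Pow {..<n}) close (\<lambda>x. transpose i j ` x) {x. j \<in> x \<and> i \<notin> x}"
proof
  fix x y :: "nat set"
  assume "x \<in> Pow {..<n}" "y \<in> Pow {..<n}"
  moreover have "transpose i j ` y \<subseteq> {..<n}"
    using \<open>y \<in> _\<close> assms by (auto simp: transpose_def)
  ultimately have fin: "finite (sym_diff x (transpose i j ` y))"
    by (auto intro: finite_subset)
  show "close (transpose i j ` x) (transpose i j ` y) \<longleftrightarrow> close x y"
  proof -
    have "sym_diff (transpose i j ` x) (transpose i j ` y) = transpose i j ` sym_diff x y"
      by (simp add: image_Un image_set_diff)
    then show ?thesis by (simp add: card_image)
  qed
  assume "x \<in> {x. j \<in> x \<and> i \<notin> x}" "y \<in> {x. j \<in> x \<and> i \<notin> x}"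
  then have "sym_diff x y \<subseteq> sym_diff x (transpose i j ` y)"
    by (auto simp: transpose_def image_iff split: if_splits)
  then show "close x (transpose i j ` y) \<Longrightarrow> close x y"
    using card_mono[OF fin] le_trans by blast
next
  fix x assume "x \<notin> {x. j \<in> x \<and> i \<notin> x}" "transpose i j ` x \<notin> {x. j \<in> x \<and> i \<notin> x}"
  then have "i \<in> x \<longleftrightarrow> j \<in> x"
    by (auto simp: transpose_def image_iff split: if_splits)
  then show "transpose i j ` x = x"
    by (auto simp: transpose_def image_iff split: if_splits)
qed (use assms in \<open>auto simp: image_image transpose_def image_iff split: if_splits\<close>)

text \<open>
  A family of least total weight, among those of the same size with at least as many close pairs,
  is fixed by every polarization that moves sets to lighter ones: another step would decrease the
  total weight. Removing an element and replacing it by a smaller one are such moves.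
\<close>

lemma ex_shifted_down_set:
  assumes "F \<subseteq> Pow {..<n}"
  obtains G where "G \<subseteq> Pow {..<n}" "card G = card F" "shifted_down_set G"
    "card {(x, y) \<in> F \<times> F. close x y} \<le> card {(x, y) \<in> G \<times> G. close x y}"
proof -
  define P where "P G \<longleftrightarrow> G \<subseteq> Pow {..<n} \<and> card G = card F \<and>
    card {(x, y) \<in> F \<times> F. close x y} \<le> card {(x, y) \<in> G \<times> G. close x y}" for G
  have "P F" using assms by (simp add: P_def)
  from ex_has_least_nat[of P F "sum weight", OF this]
  obtain G where "P G" and least: "\<forall>H. P H \<longrightarrow> sum weight G \<le> sum weight H"
    by (elim exE conjE)
  have G: "G \<subseteq> Pow {..<n}" using \<open>P G\<close> by (simp add: P_def)
  have stable: "\<sigma> x \<in> G"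
    if pol: "polarization (Pow {..<n}) close \<sigma> U"
      and lighter: "\<And>x. x \<in> Pow {..<n} \<Longrightarrow> x \<in> U \<Longrightarrow> weight (\<sigma> x) < weight x"
      and "x \<in> G" "x \<in> U" for \<sigma> U x
  proof (rule ccontr)
    interpret polarization "Pow {..<n}" close \<sigma> U by (fact pol)
    assume "\<sigma> x \<notin> G"
    then have "sum weight (polarize G) < sum weight G"
      using weight_polarize_less[of G weight x] G lighter \<open>x \<in> G\<close> \<open>x \<in> U\<close> by blast
    moreover have "P (polarize G)"
      using \<open>P G\<close> card_polarize[OF G] card_related_pairs_polarize[OF G] polarize_subset[of G]
      by (simp add: P_def)
    ultimately show False using least leD by metis
  qed
  have "shifted_down_set G"
    unfolding shifted_down_set_def
  proof (intro conjI ballI allI impI)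
    fix x a assume "x \<in> G" "a \<in> x"
    then have "a < n" using G by auto
    have "sym_diff x {a} \<in> G"
    proof (rule stable[OF polarization_flip[OF \<open>a < n\<close>] _ \<open>x \<in> G\<close>])
      fix y assume "y \<in> Pow {..<n}" "y \<in> {x. a \<in> x}"
      moreover from this have "sym_diff y {a} = y - {a}" "finite y" by (auto intro: finite_subset)
      ultimately show "weight (sym_diff y {a}) < weight y"
        by (simp add: sum.remove[of y a])
    qed (use \<open>a \<in> x\<close> in simp)
    moreover have "sym_diff x {a} = x - {a}" using \<open>a \<in> x\<close> by auto
    ultimately show "x - {a} \<in> G" by simp
  next
    fix x a b assume "x \<in> G" "a \<in> x" "b < a" "b \<notin> x"
    then have "a < n" using G by auto
    then have "b < n" using \<open>b < a\<close> by simp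
    have move: "transpose b a ` y = insert b (y - {a})" if "a \<in> y" "b \<notin> y" for y
      using that \<open>b < a\<close> by (auto simp: transpose_def image_iff split: if_splits)
    have "transpose b a ` x \<in> G"
    proof (rule stable[OF polarization_transpose _ \<open>x \<in> G\<close>])
      fix y assume "y \<in> Pow {..<n}" and y: "y \<in> {x. a \<in> x \<and> b \<notin> x}"
      then have "finite y" by (auto intro: finite_subset)
      then show "weight (transpose b a ` y) < weight y"
        using y \<open>b < a\<close> by (simp add: move sum.remove[of y a])
    qed (use \<open>a \<in> x\<close> \<open>b \<notin> x\<close> \<open>a < n\<close> \<open>b < n\<close> \<open>b < a\<close> in auto)
    then show "insert b (x - {a}) \<in> G" using move \<open>a \<in> x\<close> \<open>b \<notin> x\<close> by simp
  qed
  then show thesis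
    using that[of G] \<open>P G\<close> unfolding P_def by iprover
qed

section \<open>Counting close pairs by their larger member\<close>

text \<open>
  Each edge is listed once, starting from its larger end in the colexicographic order.
\<close>

definition descending_pairs :: "nat set set \<Rightarrow> (nat set \<times> nat set) set" where
  "descending_pairs F = {(x, y) \<in> F \<times> F. x \<noteq> y \<and> close x y \<and> Max (sym_diff x y) \<in> x}"

lemma Max_sym_diff_in:
  assumes "finite x" "finite y" "x \<noteq> y"
  shows "Max (sym_diff x y) \<in> y \<longleftrightarrow> Max (sym_diff x y) \<notin> x"
proof -
  have "Max (sym_diff x y) \<in> sym_diff x y"
    using assms by (intro Max_in) auto
  then show ?thesis by blast
qed

lemma card_close_pairs:
  assumes "F \<subseteq> Pow {..<n}"
  shows "card {(x, y) \<in> F \<times> F. close x y} = card F + 2 * card (descending_pairs F)"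
proof -
  let ?P = "{(x, y) \<in> F \<times> F. close x y}"
  define D where "D = descending_pairs F"
  have fin: "finite F" using assms by (rule finite_subset) simp
  have D_iff: "(x, y) \<in> D \<longleftrightarrow> x \<in> F \<and> y \<in> F \<and> x \<noteq> y \<and> close x y \<and> Max (sym_diff x y) \<in> x" for x y
    by (simp add: D_def descending_pairs_def)
  have "D \<subseteq> F \<times> F" by (auto simp: D_def descending_pairs_def)
  then have fin_D: "finite D"
    by (rule finite_subset) (simp add: fin)
  have Max_in_iff: "Max (sym_diff x y) \<in> y \<longleftrightarrow> Max (sym_diff x y) \<notin> x"
    if "x \<in> F" "y \<in> F" "x \<noteq> y" for x y
  proof -
    have "finite x" "finite y" using that assms by (auto intro: finite_subset)
    then show ?thesis using Max_sym_diff_in that by blast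
  qed
  have swap_iff: "(y, x) \<in> D \<longleftrightarrow> x \<in> F \<and> y \<in> F \<and> x \<noteq> y \<and> close x y \<and> Max (sym_diff x y) \<notin> x" for x y
  proof -
    have "sym_diff y x = sym_diff x y" by blast
    then show ?thesis unfolding D_iff using Max_in_iff[of x y] by metis
  qed
  have pairs: "(x, y) \<in> ?P \<longleftrightarrow> (x = y \<and> x \<in> F) \<or> (x, y) \<in> D \<or> (y, x) \<in> D" for x y
  proof (cases "x = y")
    case True
    then show ?thesis unfolding D_iff by simp
  next
    case False
    then show ?thesis unfolding swap_iff[where x=x and y=y] unfolding D_iff by blast
  qed
  have "?P = (\<lambda>x. (x, x)) ` F \<union> (D \<union> prod.swap ` D)"
  proof (rule set_eqI)
    fix p :: "nat set \<times> nat set"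
    obtain x y where p: "p = (x, y)" by fastforce
    show "p \<in> ?P \<longleftrightarrow> p \<in> (\<lambda>x. (x, x)) ` F \<union> (D \<union> prod.swap ` D)"
      unfolding p pairs by force
  qed
  moreover have "D \<inter> prod.swap ` D = {}"
  proof -
    have "\<not> ((x, y) \<in> D \<and> (y, x) \<in> D)" for x y
      unfolding swap_iff[where x=x and y=y] unfolding D_iff by blast
    then show ?thesis by auto
  qed
  moreover have "(\<lambda>x. (x, x)) ` F \<inter> (D \<union> prod.swap ` D) = {}"
    using D_iff by auto
  moreover have "card ((\<lambda>x. (x, x)) ` F) = card F" "card (prod.swap ` D) = card D"
    by (auto intro!: card_image inj_onI)
  ultimately have "card ?P = card F + (card D + card D)"
    using fin fin_D by (simp only: card_Un_disjoint finite_imageI finite_UnI)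
  then show ?thesis by (simp only: D_def mult_2)
qed

lemma obtain_Max_pair:
  fixes Z :: "nat set"
  assumes "finite Z" "Z \<noteq> {}" "card Z \<le> 2"
  obtains a b where "a = Max Z" "b \<le> a" "Z = {a, b}"
proof -
  define a where "a = Max Z"
  have a: "a \<in> Z" unfolding a_def by (rule Max_in) fact+
  have "card (Z - {a}) \<le> 1" using assms(3) a by simp
  then consider "card (Z - {a}) = 0" | "card (Z - {a}) = 1" by linarith
  then show thesis
  proof cases
    case 1
    then have "Z - {a} = {}" using assms(1) by (simp only: card_0_eq finite_Diff)
    then have "Z = {a, a}" using a by blast
    then show thesis using that a_def by blast
  next
    case 2
    then obtain b where "Z - {a} = {b}" by (rule card_1_singletonE)
    then have Z: "Z = {a, b}" "b \<in> Z" using a by blast+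
    show thesis by (rule that[OF a_def _ Z(1)]) (simp only: a_def Max_ge[OF assms(1) Z(2)])
  qed
qed

text \<open>
  For \<open>x\<close> fixed, \<open>y\<close> is determined by the difference set \<open>{a, b}\<close> with \<open>b \<le> a \<in> x\<close>, where \<open>a = b\<close> encodes
  distance 1. There are \<open>Suc a\<close> choices of \<open>b\<close> for each \<open>a\<close>.
\<close>

lemma card_descending_pairs_le_weight:
  assumes "F \<subseteq> Pow {..<n}"
  shows "card (descending_pairs F) \<le> sum weight F"
proof -
  let ?S = "SIGMA x:F. SIGMA a:x. {..a}"
  let ?f = "\<lambda>(x, a, b). (x, sym_diff x {a, b})"
  have fin: "finite F" using assms by (rule finite_subset) simp
  have finite_in: "finite x" if "x \<in> F" for x
    using that assms by (auto intro: finite_subset)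
  have "descending_pairs F \<subseteq> ?f ` ?S"
  proof
    fix p assume "p \<in> descending_pairs F"
    then obtain x y where p: "p = (x, y)" "x \<in> F" "y \<in> F" "x \<noteq> y" "close x y"
      "Max (sym_diff x y) \<in> x"
      by (auto simp: descending_pairs_def)
    define Z where "Z = sym_diff x y"
    have y: "y = sym_diff x Z" by (auto simp: Z_def)
    have "finite Z" "Z \<noteq> {}"
      using finite_in[OF p(2)] finite_in[OF p(3)] p(4) by (auto simp: Z_def)
    moreover have "card Z \<le> 2" using p(5) by (simp only: Z_def)
    ultimately obtain a b where ab: "a = Max Z" "b \<le> a" "Z = {a, b}"
      by (rule obtain_Max_pair)
    have "a \<in> x" unfolding ab(1) Z_def by (fact p(6))
    then have "(x, a, b) \<in> ?S" using p(2) ab(2) by simp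
    moreover have "p = ?f (x, a, b)"
      unfolding p(1) prod.case ab(3)[symmetric] using y by (rule arg_cong)
    ultimately show "p \<in> ?f ` ?S" by (rule rev_image_eqI)
  qed
  moreover have "finite ?S" using fin finite_in by (intro finite_SigmaI) auto
  ultimately have "card (descending_pairs F) \<le> card ?S"
    by (rule surj_card_le[rotated])
  also have "\<dots> = (\<Sum>x\<in>F. card (SIGMA a:x. {..a}))"
    using fin finite_in by (intro card_SigmaI) auto
  also have "\<dots> = sum weight F"
    using finite_in by (intro sum.cong) simp_all
  finally show ?thesis .
qed

definition support :: "nat \<Rightarrow> (nat \<Rightarrow> nat) \<Rightarrow> nat set" where
  "support n v = {i \<in> {..<n}. v i = 1}"

lemma sym_diff_support:
  assumes "v \<in> cube n" "w \<in> cube n"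
  shows "sym_diff (support n v) (support n w) = {i \<in> {..<n}. v i \<noteq> w i}"
proof -
  have "v i \<in> {0, 1}" "w i \<in> {0, 1}" if "i < n" for i
    using that assms by (auto simp: cube_def PiE_iff)
  then show ?thesis unfolding support_def by fastforce
qed

lemma inj_on_support: "inj_on (support n) (cube n)"
proof
  fix v w assume vw: "v \<in> cube n" "w \<in> cube n" "support n v = support n w"
  then have "{i \<in> {..<n}. v i \<noteq> w i} = {}"
    using sym_diff_support[of v n w] by simp
  then show "v = w"
    using vw unfolding cube_def by (intro PiE_ext[of v "{..<n}" "\<lambda>_. {0, 1}"]) auto
qed

lemma e_le2_le_card_descending_pairs:
  assumes "A \<subseteq> cube n"
  shows "e_le2 n A \<le> card (descending_pairs (support n ` A))"
proof -
  let ?D = "descending_pairs (support n ` A)"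
  let ?edge = "\<lambda>(x, y). {x, y}"
  have "finite (cube n)" by (simp add: cube_def finite_PiE)
  then have "finite A" using assms by (rule rev_finite_subset)
  moreover have "?D \<subseteq> support n ` A \<times> support n ` A" by (auto simp: descending_pairs_def)
  ultimately have fin: "finite ?D" by (meson finite_SigmaI finite_imageI finite_subset)
  have supp_edges: "(\<lambda>e. support n ` e) ` edges_le2 n A \<subseteq> ?edge ` ?D"
  proof (rule image_subsetI)
    fix e assume "e \<in> edges_le2 n A"
    then obtain v w where e: "e = {v, w}"
      and vw: "v \<in> A" "w \<in> A" "v \<noteq> w" "hamming_dist n v w \<le> 2"
      unfolding edges_le2_def by blast
    have cube: "v \<in> cube n" "w \<in> cube n" using vw assms by blast+
    define x y where "x = support n v" and "y = support n w"
    have xy: "x \<in> support n ` A" "y \<in> support n ` A" "finite x" "finite y"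
      using vw by (simp_all add: x_def y_def support_def)
    have "close x y"
      using vw(4) unfolding x_def y_def sym_diff_support[OF cube] hamming_dist_def .
    moreover have "x \<noteq> y"
      using vw(3) inj_onD[OF inj_on_support _ cube] unfolding x_def y_def by blast
    moreover have swap: "sym_diff y x = sym_diff x y" by blast
    ultimately have "(x, y) \<in> ?D \<or> (y, x) \<in> ?D"
      using xy Max_sym_diff_in[of x y]
      unfolding descending_pairs_def mem_Collect_eq prod.case swap by blast
    moreover have "support n ` e = ?edge (x, y)" "support n ` e = ?edge (y, x)"
      by (simp_all add: e x_def y_def insert_commute)
    ultimately show "support n ` e \<in> ?edge ` ?D" by (elim disjE) (rule image_eqI; assumption)+
  qed
  have "inj_on (\<lambda>e. support n ` e) (edges_le2 n A)"
  proof (rule inj_onI)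
    fix d e assume "d \<in> edges_le2 n A" "e \<in> edges_le2 n A" "support n ` d = support n ` e"
    moreover from this have "d \<subseteq> cube n" "e \<subseteq> cube n"
      using assms by (auto simp: edges_le2_def)
    ultimately show "d = e" by (simp only: inj_on_image_eq_iff[OF inj_on_support])
  qed
  then have "card (edges_le2 n A) \<le> card (?edge ` ?D)"
    by (rule card_inj_on_le[OF _ supp_edges finite_imageI[OF fin]])
  also have "\<dots> \<le> card ?D" by (rule card_image_le[OF fin])
  finally show ?thesis by (simp only: e_le2_def)
qed

section \<open>Weights in a shifted down-set\<close>

lemma shifted_down_set_shift:
  "shifted_down_set F \<Longrightarrow> x \<in> F \<Longrightarrow> a \<in> x \<Longrightarrow> b < a \<Longrightarrow> b \<notin> x \<Longrightarrow> insert b (x - {a}) \<in> F"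
  by (simp add: shifted_down_set_def)

lemma shifted_down_set_subset:
  assumes "shifted_down_set F" "x \<in> F" "finite x" "y \<subseteq> x"
  shows "y \<in> F"
proof -
  have "x - z \<in> F" if "finite z" "z \<subseteq> x" for z
    using that
  proof (induction z)
    case empty
    then show ?case using assms by simp
  next
    case (insert a z)
    then have "x - z - {a} \<in> F"
      using assms(1) by (simp add: shifted_down_set_def)
    moreover have "x - insert a z = x - z - {a}" by blast
    ultimately show ?case by simp
  qed
  from this[of "x - y"] show ?thesis
    using assms by (simp add: double_diff)
qed

text \<open>
  The elements of \<open>T\<close> are moved to their targets one at a time in increasing order. The targets of
  smaller elements are already occupied, but differ from the present one by injectivity, and the
  elements that have not moved yet (the set \<open>W\<close>) are too large to be in the way.
\<close>

lemma shifted_down_set_dominated: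
  fixes T W :: "nat set"
  assumes F: "shifted_down_set F" and "finite T" "inj_on h T" "\<And>a. a \<in> T \<Longrightarrow> h a \<le> a"
    and "T \<union> W \<in> F" "\<And>a b. a \<in> T \<Longrightarrow> b \<in> W \<Longrightarrow> a < b"
  shows "h ` T \<union> W \<in> F"
  using assms(2-)
proof (induction T arbitrary: W rule: finite_linorder_max_induct)
  case (insert t T)
  have *: "h ` T \<union> insert t W \<in> F"
  proof (rule insert.IH)
    show "inj_on h T" using insert.prems(1) by (rule inj_on_subset) blast
    show "T \<union> insert t W \<in> F" using insert.prems(3) by simp
    show "h a \<le> a" if "a \<in> T" for a using insert.prems(2)[of a] that by simp
    show "a < b" if "a \<in> T" "b \<in> insert t W" for a b
      using insert.prems(4)[of a b] insert.hyps(2) that by auto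
  qed
  show ?case
  proof (cases "h t = t")
    case True
    then show ?thesis using * by simp
  next
    case False
    then have "h t < t" using insert.prems(2)[of t] by simp
    have t: "t \<notin> h ` T" "t \<notin> W"
    proof -
      have "h a \<noteq> t" if "a \<in> T" for a
        using insert.prems(2)[of a] insert.hyps(2) that by auto
      then show "t \<notin> h ` T" by blast
      show "t \<notin> W" using insert.prems(4)[of t t] by auto
    qed
    have "h t \<noteq> h a" if "a \<in> T" for a
      using inj_onD[OF insert.prems(1), of t a] insert.hyps(2) that by auto
    then have "h t \<notin> h ` T" by blast
    moreover have "h t \<notin> W"
      using insert.prems(4)[of t "h t"] \<open>h t < t\<close> by auto
    ultimately have "h t \<notin> h ` T \<union> insert t W"
      using \<open>h t < t\<close> by auto
    with * \<open>h t < t\<close> have "insert (h t) (h ` T \<union> insert t W - {t}) \<in> F"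
      by (intro shifted_down_set_shift[OF F]) auto
    moreover have "h ` T \<union> insert t W - {t} = h ` T \<union> W" using t by simp
    ultimately show ?thesis by simp
  qed
qed simp

text \<open>
  A form of Hermite's identity: for \<open>k\<close> consecutive integers ending in \<open>a\<close>, the values
  \<open>\<lceil>(b + 1) / k\<rceil> = b div k + 1\<close> add up to exactly \<open>a + 1\<close>. The induction subtracts \<open>k\<close> from the elements of
  \<open>x\<close> that are at least \<open>k\<close> and discards the others. The former lose 1 and the latter had the value 1,
  so the sum decreases by \<open>card x \<le> k\<close>.
\<close>

lemma sum_div_le:
  fixes x :: "nat set"
  assumes "x \<subseteq> {..a}" "card x \<le> k"
  shows "(\<Sum>b\<in>x. b div k + 1) \<le> a + 1"
  using assms
proof (induction a arbitrary: x rule: less_induct)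
  case (less a)
  have fin: "finite x" using less.prems(1) by (rule finite_subset) simp
  show ?case
  proof (cases "k = 0 \<or> a < k")
    case True
    then have "b div k = 0" if "b \<in> x" for b
      using less.prems(1) that by auto
    then have "(\<Sum>b\<in>x. b div k + 1) = card x" by simp
    also have "\<dots> \<le> card {..a}" using less.prems(1) by (intro card_mono) auto
    finally show ?thesis by simp
  next
    case False
    define z where "z = {c. c + k \<in> x}"
    have img: "(\<lambda>c. c + k) ` z = {b \<in> x. k \<le> b}"
    proof (intro equalityI subsetI)
      fix b assume b: "b \<in> {b \<in> x. k \<le> b}"
      then show "b \<in> (\<lambda>c. c + k) ` z"
        by (intro image_eqI[of _ _ "b - k"]) (simp_all add: z_def)
    qed (auto simp: z_def)
    have inj: "inj_on (\<lambda>c. c + k) z" by simp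
    have "card z \<le> card x"
      using card_image[OF inj] card_mono[OF fin, of "{b \<in> x. k \<le> b}"] img by auto
    then have "(\<Sum>c\<in>z. c div k + 1) \<le> (a - k) + 1"
      using less.prems False by (intro less.IH) (auto simp: z_def)
    moreover have "(\<Sum>c\<in>z. c div k + 1) = (\<Sum>b\<in>{b \<in> x. k \<le> b}. b div k)"
      unfolding img[symmetric] using False by (simp add: sum.reindex[OF inj])
    moreover have "\<dots> = (\<Sum>b\<in>x. b div k)"
      using fin by (intro sum.mono_neutral_left) (auto simp: not_le)
    moreover have "(\<Sum>b\<in>x. b div k + 1) = (\<Sum>b\<in>x. b div k) + card x"
      by (simp only: sum.distrib card_eq_sum)
    ultimately show ?thesis
      using less.prems(2) False by linarith
  qed
qed

text \<open>
  The disjoint sets \<open>B a\<close> are consecutive intervals \<open>{s a ..< s a + c a}\<close>, laid out in the order of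
  the elements of \<open>x\<close>; \<open>sum_div_le\<close> says that the one of \<open>a\<close> ends by \<open>a\<close>. A function \<open>g\<close> with \<open>g a \<le> c a\<close>
  encodes a member of \<open>F\<close>: the element \<open>a\<close> is deleted if \<open>g a = 0\<close>, and otherwise moved to the point
  number \<open>g a\<close> of its interval. Disjointness lets one read off \<open>g\<close> from the resulting set.
\<close>

lemma prod_le_card_shifted_down_set:
  assumes F: "shifted_down_set F" "finite F" and x: "x \<in> F" "finite x"
  shows "(\<Prod>a\<in>x. a div card x + 2) \<le> card F"
proof -
  define c where "c = (\<lambda>a. a div card x + 1)"
  define s where "s a = (\<Sum>b\<in>{b \<in> x. b < a}. c b)" for a
  define h where "h g a = s a + g a - 1" for g a
  define \<Phi> where "\<Phi> g = h g ` {a \<in> x. g a \<noteq> 0}" for g :: "nat \<Rightarrow> nat"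
  let ?G = "PiE x (\<lambda>a. {..c a})"
  have step: "s a + c a = (\<Sum>b\<in>{b \<in> x. b \<le> a}. c b)" if "a \<in> x" for a
  proof -
    have "{b \<in> x. b \<le> a} = insert a {b \<in> x. b < a}" using that by auto
    then show ?thesis using x(2) by (simp add: s_def)
  qed
  have below: "s a + c a \<le> a + 1" if "a \<in> x" for a
  proof -
    have "card {b \<in> x. b \<le> a} \<le> card x" using x(2) by (intro card_mono) auto
    then have "(\<Sum>b\<in>{b \<in> x. b \<le> a}. b div card x + 1) \<le> a + 1"
      by (intro sum_div_le) auto
    then show ?thesis unfolding step[OF that] by (simp only: c_def)
  qed
  have ordered: "s a + c a \<le> s b" if "a \<in> x" "b \<in> x" "a < b" for a b
    unfolding step[OF that(1)] unfolding s_def using x(2) that by (intro sum_mono2) auto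
  have same: "a = b \<and> g a = g' b"
    if "g \<in> ?G" "g' \<in> ?G" "a \<in> x" "b \<in> x" "g a \<noteq> 0" "g' b \<noteq> 0" "h g a = h g' b" for g g' a b
  proof -
    have "g a \<le> c a" "g' b \<le> c b" using that by (auto simp: PiE_iff)
    with that ordered[of a b] ordered[of b a] show ?thesis
      by (cases a b rule: linorder_cases) (auto simp: h_def)
  qed
  have "\<Phi> ` ?G \<subseteq> F"
  proof
    fix y assume "y \<in> \<Phi> ` ?G"
    then obtain g where g: "g \<in> ?G" and y: "y = h g ` {a \<in> x. g a \<noteq> 0} \<union> {}"
      by (auto simp: \<Phi>_def)
    show "y \<in> F"
      unfolding y
    proof (rule shifted_down_set_dominated[OF F(1)])
      show "inj_on (h g) {a \<in> x. g a \<noteq> 0}"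
        using same[OF g g] by (auto intro!: inj_onI)
      show "h g a \<le> a" if "a \<in> {a \<in> x. g a \<noteq> 0}" for a
      proof -
        have "g a \<le> c a" using g that by (auto simp: PiE_iff)
        then show ?thesis using below[of a] that by (simp add: h_def)
      qed
      show "{a \<in> x. g a \<noteq> 0} \<union> {} \<in> F"
        using shifted_down_set_subset[OF F(1) x] by simp
    qed (use x in auto)
  qed
  moreover have "inj_on \<Phi> ?G"
  proof (rule inj_onI)
    fix g g' assume g: "g \<in> ?G" "g' \<in> ?G" "\<Phi> g = \<Phi> g'"
    have agree: "u a = v a" if "u \<in> ?G" "v \<in> ?G" "\<Phi> u = \<Phi> v" "a \<in> x" "u a \<noteq> 0" for u v a
    proof -
      have "h u a \<in> \<Phi> v" using that by (auto simp: \<Phi>_def)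
      then obtain b where "b \<in> x" "v b \<noteq> 0" "h u a = h v b" by (auto simp: \<Phi>_def)
      then show ?thesis using same[of u v a b] that by auto
    qed
    show "g = g'"
    proof (rule PiE_ext[OF g(1,2)])
      fix a assume "a \<in> x"
      then show "g a = g' a"
        using agree[of g g' a] agree[of g' g a] g by (cases "g a = 0") force+
    qed
  qed
  ultimately have "card ?G \<le> card F"
    using F(2) card_inj_on_le by blast
  moreover have "card ?G = (\<Prod>a\<in>x. a div card x + 2)"
    using x(2) by (simp add: card_PiE c_def)
  ultimately show ?thesis by simp
qed

text \<open>
  Concavity of the logarithm between \<open>1\<close> and \<open>1 + u\<close>, from the tangent bound \<open>ln z \<le> z - 1\<close> at
  \<open>z = (1 + u) / v\<close> and \<open>z = 1 / v\<close>, with weights \<open>t\<close> and \<open>1 - t\<close>, where \<open>v = 1 + t * u\<close>.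
\<close>

lemma mult_ln_le_ln_one_plus:
  fixes t u :: real
  assumes "0 \<le> t" "t \<le> 1" "0 \<le> u"
  shows "t * ln (1 + u) \<le> ln (1 + t * u)"
proof -
  define v where "v = 1 + t * u"
  have v: "0 < v" using assms by (simp add: v_def add_pos_nonneg)
  have "t * (ln (1 + u) - ln v) \<le> t * ((1 + u) / v - 1)"
    using assms v ln_le_minus_one[of "(1 + u) / v"] by (intro mult_left_mono) (auto simp: ln_div)
  moreover have "(1 - t) * (- ln v) \<le> (1 - t) * (1 / v - 1)"
    using assms v ln_le_minus_one[of "1 / v"] by (intro mult_left_mono) (auto simp: ln_div)
  moreover have "t * ((1 + u) / v - 1) + (1 - t) * (1 / v - 1) = 0"
  proof -
    have "t * ((1 + u) / v - 1) + (1 - t) * (1 / v - 1) = (1 + t * u) / v - 1"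
      by (simp add: add_divide_distrib diff_divide_distrib algebra_simps)
    then show ?thesis using v by (simp add: v_def)
  qed
  ultimately show ?thesis by (simp add: v_def algebra_simps)
qed

context
  fixes F :: "nat set set" and n :: nat and L :: real
  assumes F: "F \<subseteq> Pow {..<n}" "shifted_down_set F"
    and L: "L = log 2 (card F)"
begin

lemma card_le_log_card_shifted_down_set:
  assumes x: "x \<in> F"
  shows "card x \<le> L"
proof -
  have fin: "finite F" using F(1) by (rule finite_subset) simp
  have "finite x" using F(1) x by (auto intro: finite_subset)
  moreover have "Pow x \<subseteq> F"
    using shifted_down_set_subset[OF F(2) x \<open>finite x\<close>] by blast
  ultimately have "2 ^ card x \<le> card F"
    using card_mono[OF fin] by (simp add: card_Pow[symmetric])
  then have "2 ^ card x \<le> real (card F)"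
    by (metis of_nat_le_iff of_nat_numeral of_nat_power)
  moreover have "0 < card F" using x fin by (auto simp: card_gt_0_iff)
  ultimately show ?thesis by (simp add: L le_log_iff powr_realpow)
qed

lemma weight_le_floor:
  assumes x: "x \<in> F"
  shows "weight x \<le> n * \<lfloor>L\<rfloor>"
proof -
  have "a < n" if "a \<in> x" for a using F(1) x that by auto
  then have "weight x \<le> of_nat (card x) * n"
    by (intro sum_bounded_above Suc_leI)
  moreover have "int (card x) \<le> \<lfloor>L\<rfloor>"
    using card_le_log_card_shifted_down_set[OF x] by (simp add: le_floor_iff)
  then have "int (card x) * int n \<le> \<lfloor>L\<rfloor> * int n" by (rule mult_right_mono) simp
  ultimately show ?thesis by (simp add: mult.commute flip: of_nat_mult of_nat_sum)
qed

text \<open>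
  The logarithm of \<open>prod_le_card_shifted_down_set\<close>, where each factor is bounded below by concavity
  in proportion to \<open>Suc a\<close>, so that the sum of the bounds is a multiple of the weight.
\<close>

lemma weight_mult_log_le:
  assumes x: "x \<in> F" and L_bounds: "0 \<le> L" "L < n"
  shows "weight x * log 2 (n / L) \<le> n * L"
proof (cases "x = {}")
  case True
  then show ?thesis using L_bounds by simp
next
  case False
  have fin: "finite F" using F(1) by (rule finite_subset) simp
  have fin_x: "finite x" using F(1) x by (auto intro: finite_subset)
  define k where "k = card x"
  have k: "0 < k" "k \<le> L"
    using False fin_x card_le_log_card_shifted_down_set[OF x] by (auto simp: k_def)
  then have "0 < L" by linarith
  have n: "0 < n" using L_bounds by linarith
  have pointwise: "Suc a / n * ln (n / L) \<le> ln (a div k + 2)" if "a \<in> x" for a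
  proof -
    have "a < n" using F(1) x that by auto
    then have a: "Suc a \<le> n" by (rule Suc_leI)
    have "n / L \<le> 1 + n / k"
      using k L_bounds by (intro order_trans[OF divide_left_mono[of k L n]]) auto
    then have "Suc a / n * ln (n / L) \<le> Suc a / n * ln (1 + n / k)"
      using L_bounds \<open>0 < L\<close> n by (intro mult_left_mono) (auto intro: ln_mono)
    also have "\<dots> \<le> ln (1 + Suc a / n * (n / k))"
      using a n by (intro mult_ln_le_ln_one_plus) auto
    also have "Suc a / n * (n / k) = Suc a / k" using n by simp
    also have "ln (1 + Suc a / k) \<le> ln (a div k + 2)"
    proof -
      have "Suc a \<le> (a div k + 1) * k"
        using dividend_less_div_times[OF k(1), of a] by (simp add: algebra_simps)
      then have "real (Suc a) \<le> (a div k + 1) * real k"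
        by (metis of_nat_1 of_nat_add of_nat_le_iff of_nat_mult)
      then have "Suc a / k \<le> a div k + 1" using k by (simp add: divide_le_eq)
      then show ?thesis using k by (intro ln_mono) (auto simp: add_pos_nonneg)
    qed
    finally show ?thesis .
  qed
  have "weight x / n * ln (n / L) = (\<Sum>a\<in>x. Suc a / n * ln (n / L))"
    by (simp add: sum_distrib_right sum_divide_distrib)
  also have "\<dots> \<le> (\<Sum>a\<in>x. ln (a div k + 2))" by (rule sum_mono) (rule pointwise)
  also have "\<dots> = ln (real (\<Prod>a\<in>x. a div k + 2))"
    using fin_x by (simp add: ln_prod add_nonneg_pos add.commute)
  also have "\<dots> \<le> ln (card F)"
    using prod_le_card_shifted_down_set[OF F(2) fin x fin_x]
    by (intro ln_mono) (auto simp: k_def simp del: of_nat_prod intro!: prod_pos)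
  also have "\<dots> = L * ln 2" by (simp add: L log_def)
  finally show ?thesis
    using n by (simp add: log_def field_simps)
qed

end

section \<open>The edge bound\<close>

theorem theorem8:
  fixes n :: nat and A :: "(nat \<Rightarrow> nat) set" and l' :: int
  assumes "n > 0"
    and "A \<subseteq> cube n"
    and "1 \<le> log 2 (real (card A))"
    and "log 2 (real (card A)) < real n"
    and "l' = min \<lceil>log 2 (real (card A)) / (log 2 (real n) - log 2 (log 2 (real (card A))))\<rceil>
                  \<lfloor>log 2 (real (card A))\<rfloor>"
  shows "real (e_le2 n A) \<le> real n * real_of_int l' * real (card A)"
proof -
  define L where "L = log 2 (real (card A))"
  have L: "1 \<le> L" "L < n" using assms by (simp_all add: L_def)
  have log_ratio: "log 2 n - log 2 L = log 2 (n / L)"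
    using L by (simp add: log_divide)
  have supports: "support n ` A \<subseteq> Pow {..<n}" by (auto simp: support_def)
  have card_supports: "card (support n ` A) = card A"
    using inj_on_subset[OF inj_on_support assms(2)] by (rule card_image)
  obtain G where G: "G \<subseteq> Pow {..<n}" "card G = card (support n ` A)" "shifted_down_set G"
    "card {(x, y) \<in> support n ` A \<times> support n ` A. close x y}
       \<le> card {(x, y) \<in> G \<times> G. close x y}"
    using ex_shifted_down_set[OF supports] .
  have L_G: "L = log 2 (card G)" using G(2) card_supports by (simp add: L_def)
  have "e_le2 n A \<le> card (descending_pairs (support n ` A))"
    by (rule e_le2_le_card_descending_pairs[OF assms(2)])
  also have "\<dots> \<le> card (descending_pairs G)"
    using G(2,4) card_close_pairs[OF supports] card_close_pairs[OF G(1)] by simp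
  also have "\<dots> \<le> sum weight G"
    by (rule card_descending_pairs_le_weight[OF G(1)])
  finally have "real (e_le2 n A) \<le> (\<Sum>x\<in>G. real (weight x))"
    by (metis of_nat_le_iff of_nat_sum)
  also have "\<dots> \<le> (\<Sum>x\<in>G. n * real_of_int l')"
  proof (rule sum_mono)
    fix x assume x: "x \<in> G"
    let ?c = "\<lceil>L / (log 2 n - log 2 L)\<rceil>"
    have "real_of_int (int (weight x)) \<le> real_of_int (int n * \<lfloor>L\<rfloor>)"
      using weight_le_floor[OF G(1,3) L_G x] by (simp only: of_int_le_iff)
    then have floor: "real (weight x) \<le> n * real_of_int \<lfloor>L\<rfloor>" by simp
    have "0 < log 2 (n / L)" using L by simp
    then have "real (weight x) \<le> n * (L / log 2 (n / L))"
      using weight_mult_log_le[OF G(1,3) L_G x] L by (simp add: pos_le_divide_eq)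
    also have "\<dots> \<le> n * real_of_int ?c"
      unfolding log_ratio by (intro mult_left_mono) auto
    finally have "real (weight x) \<le> n * real_of_int ?c" .
    with floor show "real (weight x) \<le> n * real_of_int l'"
      unfolding assms(5) L_def[symmetric] by (simp add: min_def)
  qed
  also have "\<dots> = real n * real_of_int l' * real (card A)"
    using G(2) card_supports by simp
  finally show ?thesis .
qed

end
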